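(* Let $N\in\mathbb{N}$ and let $\{\phi_k : k\in I_N\}$ be the APK polynomials on the triangle $\mathbb{T}$, which satisfy the eigenvalue equation $-D\phi_k=-\lambda_k\phi_k$, where $D$ is the differential operator of the APK polynomials. Let $P_\phi$ denote the projection onto the span of $\{\phi_k\}_{k\in I_N}$, let $p\in\mathbb{N}$, and let $\varepsilon_N>0$. Then solving the viscosity equation $$\frac{\partial}{\partial t}u_N(\boldsymbol{x},t)+\nabla_{\boldsymbol{x}}\cdot P_\phi f(u_N(\boldsymbol{x},t))=\varepsilon_N(-1)^{p+1}(-D)^p u_N(\boldsymbol{x},t),\qquad u_N(\boldsymbol{x},t)=\sum_{k\in I_N}\hat u_k(t)\phi_k(\boldsymbol{x}),$$ by the splitting method with time step $\Delta t$ is equivalent to multiplying the coefficients $\hat u_k$ by $$\sigma(k)=e^{-\varepsilon_N\,\Delta t\,\lambda_k^p}$$ in every update step (of length $\Delta t$) for the equation $$\frac{\partial}{\partial t}u_N(\boldsymbol{x},t)+\nabla_{\boldsymbol{x}}\cdot P_\phi f(u_N(\boldsymbol{x},t))=0 .$$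
   Context: $\mathbb{T}=\{(x,y)\in\mathbb{R}^2:x\ge0,\ y\ge0,\ x+y\le1\}$. Parameters $\alpha,\beta,\gamma\in\mathbb{N}=\{1,2,\dots\}$ with $\gamma>\alpha+\beta-1$ are fixed. APK polynomials: for $m,l\in\mathbb{N}_0$, $$A_{m,l}(x,y)=P_m^{\alpha-1,\gamma-\alpha+2l}(1-2x)\,P_l^{\gamma-\alpha-\beta,\beta-1}\!\left(\frac{2y}{1-x}-1\right)(1-x)^l,$$ with $P_n^{a,b}$ the Jacobi polynomials. $\{\phi_k\}_{k\in I_N}$ is the finite family of the $A_{m,l}$ with $m+l\le N$, listed in lexicographic order, with $k$ corresponding to $(m,l)$. Differential operator of the APK polynomials: $$D=(x^2-x)\frac{\partial^2}{\partial x^2}+2xy\frac{\partial^2}{\partial x\partial y}+(y^2-y)\frac{\partial^2}{\partial y^2}+[(\gamma+1)x-\alpha]\frac{\partial}{\partial x}+[(\gamma+1)y-\beta]\frac{\partial}{\partial y},$$ and $DA_{m,l}=\lambda_{m,l}A_{m,l}$ with $\lambda_{m,l}=(m+l)(m+l+\gamma)$; $\lambda_k$ denotes $\lambda_{m,l}$ for the $k$ corresponding to $(m,l)$. $f$ is the (given) flux function of the conservation law $u_t+\nabla\cdot f(u)=0$. Splitting method: in each time step from $t^n$ to $t^{n+1}=t^n+\Delta t$ the viscosity equation is split into the two sub-equations (i) $\frac{\partial}{\partial t}u_N=\varepsilon_N(-1)^{p+1}(-D)^pu_N$ and (ii) $\frac{\partial}{\partial t}u_N+\nabla_{\boldsymbol{x}}\cdot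 P_\phi f(u_N)=0$, which are solved successively, each over a time interval of length $\Delta t$ (sub-equation (i) exactly), the result of one serving as initial datum for the other. "Equivalent" means that performing sub-step (i), on an arbitrary $u_N$ in the span of the $\phi_k$, is the same as replacing $\hat u_k(t^n)$ by $\hat u_k(t^{n+1})=\sigma(k)\hat u_k(t^n)$ for all $k\in I_N$, so that the splitting method coincides with the update steps for (ii) combined with this multiplication of coefficients. *)

theory Defs
  imports "HOL-Analysis.Analysis" "HOL-Computational_Algebra.Polynomial"
begin

type_synonym plane_fun = "real \<times> real \<Rightarrow> real"

definition triangle :: "(real \<times> real) set" where
  "triangle = {(x, y). 0 \<le> x \<and> 0 \<le> y \<and> x + y \<le> 1}"

text \<open>
  Jacobi polynomials in the standard normalisation, expanded at \<open>z = 1\<close> (DLMF 18.5.7);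
  the inner polynomial is \<open>(z - 1) / 2\<close>.
\<close>

definition jacobi_poly :: "nat \<Rightarrow> real \<Rightarrow> real \<Rightarrow> real poly" where
  "jacobi_poly n a b =
     (\<Sum>i\<le>n. smult (pochhammer (real n + a + b + 1) i * pochhammer (a + real i + 1) (n - i)
                    / (fact i * fact (n - i)))
             ([:-1/2, 1/2:] ^ i))"

lemma degree_jacobi_poly_le: "degree (jacobi_poly n a b) \<le> n"
  unfolding jacobi_poly_def
proof (rule degree_sum_le)
  fix i assume "i \<in> {..n}"
  have "degree ([:-1/2, 1/2:] ^ i :: real poly) \<le> degree [:-1/2, 1/2 :: real:] * i"
    by (rule degree_power_le)
  then show "degree (smult (pochhammer (real n + a + b + 1) i * pochhammer (a + real i + 1) (n - i)
                    / (fact i * fact (n - i))) ([:-1/2, 1/2:] ^ i)) \<le> n"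
    using \<open>i \<in> {..n}\<close> degree_smult_le[of _ "[:-1/2, 1/2:] ^ i :: real poly"]
    by (auto intro: order_trans)
qed simp

text \<open>
  \<open>homogenised q l u v\<close> is the polynomial in \<open>u\<close>, \<open>v\<close> that extends \<open>q (u / v) * v ^ l\<close> to
  \<open>v = 0\<close>, for \<open>q\<close> of degree at most \<open>l\<close>. It makes the APK polynomials polynomials on the
  whole plane, in spite of the quotient \<open>2 y / (1 - x) - 1 = (2 y - (1 - x)) / (1 - x)\<close>.
\<close>

definition homogenised :: "real poly \<Rightarrow> nat \<Rightarrow> real \<Rightarrow> real \<Rightarrow> real" where
  "homogenised q l u v = (\<Sum>i\<le>l. coeff q i * u ^ i * v ^ (l - i))"

definition apk :: "nat \<Rightarrow> nat \<Rightarrow> nat \<Rightarrow> nat \<times> nat \<Rightarrow> plane_fun" where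
  "apk \<alpha> \<beta> \<gamma> = (\<lambda>(m, l) (x, y).
     poly (jacobi_poly m (real \<alpha> - 1) (real \<gamma> - real \<alpha> + 2 * real l)) (1 - 2 * x) *
     homogenised (jacobi_poly l (real \<gamma> - real \<alpha> - real \<beta>) (real \<beta> - 1)) l
       (2 * y - (1 - x)) (1 - x))"

lemma homogenised_eq:
  assumes "degree q \<le> l" "v \<noteq> 0"
  shows "homogenised q l u v = poly q (u / v) * v ^ l"
proof -
  have "poly q (u / v) = (\<Sum>i\<le>l. coeff q i * (u / v) ^ i)"
    unfolding poly_altdef using assms(1)
    by (intro sum.mono_neutral_left) (auto simp: coeff_eq_0)
  moreover have "(u / v) ^ i * v ^ l = u ^ i * v ^ (l - i)" if "i \<le> l" for i
    using that assms(2) by (simp add: power_divide power_diff)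
  ultimately show ?thesis
    by (simp add: homogenised_def sum_distrib_right mult.assoc)
qed

lemma apk_eq:
  assumes "x \<noteq> 1"
  shows "apk \<alpha> \<beta> \<gamma> (m, l) (x, y) =
     poly (jacobi_poly m (real \<alpha> - 1) (real \<gamma> - real \<alpha> + 2 * real l)) (1 - 2 * x) *
     poly (jacobi_poly l (real \<gamma> - real \<alpha> - real \<beta>) (real \<beta> - 1)) (2 * y / (1 - x) - 1) *
     (1 - x) ^ l"
proof -
  have "(2 * y - (1 - x)) / (1 - x) = 2 * y / (1 - x) - 1"
    using assms by (simp add: diff_divide_distrib)
  then show ?thesis
    using assms by (simp add: apk_def homogenised_eq[OF degree_jacobi_poly_le])
qed

definition apk_index :: "nat \<Rightarrow> (nat \<times> nat) set" where
  "apk_index N = {(m, l). m + l \<le> N}"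

definition apk_eigenvalue :: "nat \<Rightarrow> nat \<times> nat \<Rightarrow> real" where
  "apk_eigenvalue \<gamma> = (\<lambda>(m, l). real ((m + l) * (m + l + \<gamma>)))"

definition pd_x :: "plane_fun \<Rightarrow> plane_fun" where
  "pd_x g = (\<lambda>(x, y). deriv (\<lambda>s. g (s, y)) x)"

definition pd_y :: "plane_fun \<Rightarrow> plane_fun" where
  "pd_y g = (\<lambda>(x, y). deriv (\<lambda>s. g (x, s)) y)"

definition apk_operator :: "nat \<Rightarrow> nat \<Rightarrow> nat \<Rightarrow> plane_fun \<Rightarrow> plane_fun" where
  "apk_operator \<alpha> \<beta> \<gamma> g = (\<lambda>(x, y).
     (x\<^sup>2 - x) * pd_x (pd_x g) (x, y) + 2 * x * y * pd_x (pd_y g) (x, y)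
     + (y\<^sup>2 - y) * pd_y (pd_y g) (x, y)
     + ((real \<gamma> + 1) * x - real \<alpha>) * pd_x g (x, y)
     + ((real \<gamma> + 1) * y - real \<beta>) * pd_y g (x, y))"

definition expansion :: "('k \<Rightarrow> plane_fun) \<Rightarrow> 'k set \<Rightarrow> ('k \<Rightarrow> real) \<Rightarrow> plane_fun" where
  "expansion \<phi> I c = (\<lambda>z. \<Sum>k\<in>I. c k * \<phi> k z)"

abbreviation span_of :: "('k \<Rightarrow> plane_fun) \<Rightarrow> 'k set \<Rightarrow> plane_fun set" where
  "span_of \<phi> I \<equiv> range (expansion \<phi> I)"

text \<open>
  Linear projection onto \<open>S\<close>, defined on a space \<open>X\<close> of functions (such as a weighted
  \<open>L\<^sup>2\<close> space for orthogonal projection, or the continuous functions for interpolation).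
  Outside \<open>X\<close> the values of \<open>P\<close> are irrelevant.
\<close>

definition projection_onto ::
    "plane_fun set \<Rightarrow> plane_fun set \<Rightarrow> (plane_fun \<Rightarrow> plane_fun) \<Rightarrow> bool" where
  "projection_onto X S P \<longleftrightarrow>
     S \<subseteq> X \<and>
     (\<forall>g\<in>X. \<forall>h\<in>X. \<forall>a b. (\<lambda>z. a * g z + b * h z) \<in> X \<and>
        P (\<lambda>z. a * g z + b * h z) = (\<lambda>z. a * P g z + b * P h z)) \<and>
     P ` X \<subseteq> S \<and> (\<forall>g\<in>S. P g = g)"

text \<open>
  Evolution equations are written \<open>\<partial>u/\<partial>t = R u\<close>. The two parts of the viscosity equation have
  right-hand sides \<open>conservation_rhs P f\<close> and \<open>viscosity_rhs D \<epsilon> p\<close>, and \<open>P\<close> acts on the flux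
  componentwise.
\<close>

definition conservation_rhs ::
    "(plane_fun \<Rightarrow> plane_fun) \<Rightarrow> (real \<Rightarrow> real \<times> real) \<Rightarrow> plane_fun \<Rightarrow> plane_fun" where
  "conservation_rhs P f u =
     (\<lambda>z. - (pd_x (P (\<lambda>w. fst (f (u w)))) z + pd_y (P (\<lambda>w. snd (f (u w)))) z))"

definition viscosity_rhs ::
    "(plane_fun \<Rightarrow> plane_fun) \<Rightarrow> real \<Rightarrow> nat \<Rightarrow> plane_fun \<Rightarrow> plane_fun" where
  "viscosity_rhs D \<epsilon> p u = (\<lambda>z. \<epsilon> * (-1) ^ (p + 1) * (((\<lambda>g w. - D g w) ^^ p) u) z)"

definition solves_on ::
    "('k \<Rightarrow> plane_fun) \<Rightarrow> 'k set \<Rightarrow> (plane_fun \<Rightarrow> plane_fun) \<Rightarrow> real \<Rightarrow> real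
      \<Rightarrow> (real \<Rightarrow> 'k \<Rightarrow> real) \<Rightarrow> bool" where
  "solves_on \<phi> I R t0 t1 c \<longleftrightarrow>
     (\<forall>t\<in>{t0..t1}. \<forall>z\<in>triangle.
        ((\<lambda>s. expansion \<phi> I (c s) z) has_real_derivative R (expansion \<phi> I (c t)) z)
          (at t within {t0..t1}))"

text \<open>
  One-step methods are relations between the data at \<open>t\<close> and at \<open>t + \<tau>\<close>, so that
  non-existence and non-uniqueness need no special treatment; the equations are autonomous.
\<close>

type_synonym one_step_method =
  "(plane_fun \<Rightarrow> plane_fun) \<Rightarrow> real \<Rightarrow> plane_fun \<Rightarrow> plane_fun \<Rightarrow> bool"

definition exact_step :: "('k \<Rightarrow> plane_fun) \<Rightarrow> 'k set \<Rightarrow> one_step_method" where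
  "exact_step \<phi> I R \<tau> u v \<longleftrightarrow>
     (\<exists>c. solves_on \<phi> I R 0 \<tau> c \<and> u = expansion \<phi> I (c 0) \<and> v = expansion \<phi> I (c \<tau>))"

definition multiply_coeffs ::
    "('k \<Rightarrow> plane_fun) \<Rightarrow> 'k set \<Rightarrow> ('k \<Rightarrow> real) \<Rightarrow> plane_fun \<Rightarrow> plane_fun \<Rightarrow> bool" where
  "multiply_coeffs \<phi> I \<sigma> u v \<longleftrightarrow>
     (\<exists>c. u = expansion \<phi> I c \<and> v = expansion \<phi> I (\<lambda>k. \<sigma> k * c k))"

text \<open>
  Sub-steps may be carried out in either order; \<open>first\<close> tells whether \<open>A\<close> precedes \<open>B\<close>.
\<close>

definition successively ::
    "bool \<Rightarrow> ('a \<Rightarrow> 'a \<Rightarrow> bool) \<Rightarrow> ('a \<Rightarrow> 'a \<Rightarrow> bool) \<Rightarrow> 'a \<Rightarrow> 'a \<Rightarrow> bool" where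
  "successively first A B = (if first then A OO B else B OO A)"

text \<open>
  Both schemes for \<open>\<partial>u/\<partial>t = R u + V u\<close> produce the values \<open>u n\<close> at the times \<open>t0 + n \<Delta>t\<close>. The
  equation \<open>\<partial>u/\<partial>t = R u\<close> is advanced by \<open>integrator\<close>, which may be \<open>exact_step\<close> or a
  numerical time integrator.
\<close>

definition splitting_method ::
    "('k \<Rightarrow> plane_fun) \<Rightarrow> 'k set \<Rightarrow> bool \<Rightarrow> one_step_method \<Rightarrow> (plane_fun \<Rightarrow> plane_fun)
      \<Rightarrow> (plane_fun \<Rightarrow> plane_fun) \<Rightarrow> real \<Rightarrow> (nat \<Rightarrow> plane_fun) \<Rightarrow> bool" where
  "splitting_method \<phi> I first integrator R V \<Delta>t u \<longleftrightarrow>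
     (\<forall>n. successively first (exact_step \<phi> I V \<Delta>t) (integrator R \<Delta>t) (u n) (u (Suc n)))"

definition filtered_method ::
    "('k \<Rightarrow> plane_fun) \<Rightarrow> 'k set \<Rightarrow> bool \<Rightarrow> one_step_method \<Rightarrow> (plane_fun \<Rightarrow> plane_fun)
      \<Rightarrow> ('k \<Rightarrow> real) \<Rightarrow> real \<Rightarrow> (nat \<Rightarrow> plane_fun) \<Rightarrow> bool" where
  "filtered_method \<phi> I first integrator R \<sigma> \<Delta>t u \<longleftrightarrow>
     (\<forall>n. successively first (multiply_coeffs \<phi> I \<sigma>) (integrator R \<Delta>t) (u n) (u (Suc n)))"

end

theory Submission
  imports Defs
begin

text \<open>
  The APK polynomials are eigenfunctions of \<open>D\<close>, so sub-equation (i) acts diagonally on the span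
  and reduces to \<open>c\<^sub>k' = - \<epsilon> \<lambda>\<^sub>k\<^sup>p c\<^sub>k\<close>, provided that the coefficients
  can be read off from the values on the triangle.

  For the eigenvalue equation, expand the second Jacobi factor at \<open>1\<close>, so that \<open>A\<^sub>m\<^sub>l\<close> is a sum of
  terms \<open>q(x) (x + y - 1)\<^sup>i (1 - x)\<^sup>l\<^sup>-\<^sup>i\<close>. By Euler's relation for homogeneous functions of
  \<open>(x + y - 1, 1 - x)\<close>, \<open>D\<close> acts on such a term as a Jacobi operator on \<open>q\<close>, up to two terms of
  degree \<open>l - 1\<close> which telescope because of the recurrence of the Jacobi coefficients.

  Linear independence on the triangle follows by comparing degrees, first in \<open>y\<close> and then in \<open>x\<close>.
  It makes each coefficient a linear combination of finitely many point values, hence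
  differentiable in time whenever the point values are.
\<close>

section \<open>Jacobi polynomials\<close>

text \<open>The value \<open>0\<close> for \<open>i > n\<close> makes the recurrence below hold for all \<open>i\<close>.\<close>

definition jacobi_coeff :: "nat \<Rightarrow> real \<Rightarrow> real \<Rightarrow> nat \<Rightarrow> real" where
  "jacobi_coeff n a b i =
     (if i \<le> n then pochhammer (real n + a + b + 1) i * pochhammer (a + real i + 1) (n - i)
                    / (fact i * fact (n - i)) else 0)"

text \<open>From \<open>i\<close> to \<open>i + 1\<close> the first Pochhammer symbol gains its next
  factor, the second loses its first factor \<open>a + i + 1\<close>, and the factorials change by
  \<open>i + 1\<close> and \<open>n - i\<close>. At \<open>i = n\<close> the right side vanishes, in
  agreement with the default \<open>0\<close>.\<close>

lemma jacobi_coeff_Suc: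
  "jacobi_coeff n a b (Suc i) * ((real i + 1) * (a + real i + 1)) =
   jacobi_coeff n a b i * ((real n - real i) * (real n + a + b + 1 + real i))"
proof (cases "i < n")
  case True
  then obtain d where d: "n = Suc (i + d)"
    using less_imp_Suc_add by blast
  have "pochhammer (a + real i + 1) (Suc d) = (a + real i + 1) * pochhammer (a + real (Suc i) + 1) d"
    by (simp add: pochhammer_rec algebra_simps)
  then show ?thesis
    using d by (simp add: jacobi_coeff_def pochhammer_Suc divide_simps)
next
  case False
  then show ?thesis
    by (cases "i = n") (auto simp: jacobi_coeff_def)
qed

lemma jacobi_coeff_top_nonzero:
  assumes "0 \<le> a" "0 \<le> b"
  shows "jacobi_coeff n a b n \<noteq> 0"
proof -
  have "pochhammer (real n + a + b + 1) n > 0"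
    using assms by (intro pochhammer_pos) simp
  then show ?thesis
    by (simp add: jacobi_coeff_def)
qed

lemma jacobi_poly_eq_sum:
  "jacobi_poly n a b = (\<Sum>i\<le>n. smult (jacobi_coeff n a b i) ([:-1/2, 1/2:] ^ i))"
  by (simp add: jacobi_poly_def jacobi_coeff_def)

lemma coeff_jacobi_poly_top: "coeff (jacobi_poly n a b) n = jacobi_coeff n a b n / 2 ^ n"
proof -
  have deg: "degree ([:-1/2, 1/2:] ^ i :: real poly) = i" for i
    by (simp add: degree_power_eq)
  have "coeff ([:-1/2, 1/2:] ^ i :: real poly) n = (if i = n then (1/2) ^ n else 0)" if "i \<le> n" for i
    using that deg[of i] lead_coeff_power[of "[:-1/2, 1/2:] :: real poly" n]
    by (auto simp: coeff_eq_0 deg)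
  then have "coeff (jacobi_poly n a b) n = (\<Sum>i\<le>n. jacobi_coeff n a b i * (if i = n then (1/2) ^ n else 0))"
    by (simp add: jacobi_poly_eq_sum coeff_sum)
  then show ?thesis
    by (simp add: power_one_over divide_simps if_distrib cong: if_cong)
qed

lemma degree_jacobi_poly:
  assumes "0 \<le> a" "0 \<le> b"
  shows "degree (jacobi_poly n a b) = n"
  using assms le_degree[of "jacobi_poly n a b" n] degree_jacobi_poly_le[of n a b]
  by (simp add: coeff_jacobi_poly_top jacobi_coeff_top_nonzero)

text \<open>In the expansion at \<open>z = 1\<close>, setting \<open>z = u / v\<close> gives
  \<open>(z - 1) / 2 = (u - v) / (2 * v)\<close>; for an APK polynomial, \<open>(u - v) / 2\<close>
  is \<open>x + y - 1\<close>. At \<open>v = 0\<close> only the terms with \<open>i = l\<close>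
  survive, and the top coefficients match.\<close>

lemma homogenised_jacobi_poly:
  "homogenised (jacobi_poly l a b) l u v =
   (\<Sum>i\<le>l. jacobi_coeff l a b i * ((u - v) / 2) ^ i * v ^ (l - i))"
proof (cases "v = 0")
  case False
  have "((u / v - 1) / 2) ^ i * v ^ l = ((u - v) / 2) ^ i * v ^ (l - i)" if "i \<in> {..l}" for i
  proof -
    have "(u / v - 1) / 2 * v = (u - v) / 2"
      using False by (simp add: field_simps)
    moreover have "v ^ l = v ^ i * v ^ (l - i)"
      using that by (simp flip: power_add)
    ultimately show ?thesis
      by (metis mult.assoc power_mult_distrib)
  qed
  moreover have "poly (jacobi_poly l a b) (u / v) * v ^ l
      = (\<Sum>i\<le>l. jacobi_coeff l a b i * (((u / v - 1) / 2) ^ i * v ^ l))"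
    by (simp add: jacobi_poly_eq_sum poly_sum sum_distrib_right mult.assoc diff_divide_distrib)
  ultimately show ?thesis
    using False
    by (simp add: homogenised_eq[OF degree_jacobi_poly_le] mult.assoc)
next
  case True
  have "(\<Sum>i\<le>l. c i * u ^ i * 0 ^ (l - i)) = c l * u ^ l" for c :: "nat \<Rightarrow> real" and u :: real
    by (simp add: power_0_left if_distrib sum.If_cases Int_def cong: if_cong)
  from this[of "coeff (jacobi_poly l a b)" u] this[of "\<lambda>i. jacobi_coeff l a b i / 2 ^ i" u] show ?thesis
    using True by (simp add: homogenised_def coeff_jacobi_poly_top power_divide)
qed

definition jacobi_shifted :: "nat \<Rightarrow> real \<Rightarrow> real \<Rightarrow> real poly" where
  "jacobi_shifted n a b = (\<Sum>i\<le>n. monom ((-1) ^ i * jacobi_coeff n a b i) i)"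

lemma coeff_jacobi_shifted: "coeff (jacobi_shifted n a b) i = (-1) ^ i * jacobi_coeff n a b i"
  by (simp add: jacobi_shifted_def coeff_sum) (simp add: jacobi_coeff_def)

lemma poly_jacobi_shifted: "poly (jacobi_shifted n a b) x = poly (jacobi_poly n a b) (1 - 2 * x)"
proof -
  have "-(1 / 2) + (1 - 2 * x) / 2 = - x"
    by (simp add: field_simps)
  then show ?thesis
    by (simp add: jacobi_shifted_def jacobi_poly_eq_sum poly_sum poly_monom power_minus[of x] mult_ac)
qed

text \<open>This is the Jacobi differential equation in the variable \<open>x = (1 - z) / 2\<close>;
  comparing coefficients of \<open>x ^ i\<close> leaves exactly the recurrence
  \<open>jacobi_coeff_Suc\<close>.\<close>

lemma jacobi_shifted_ode:
  fixes n :: nat and a b x :: real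
  defines "q \<equiv> jacobi_shifted n a b"
  shows "(x\<^sup>2 - x) * poly (pderiv (pderiv q)) x + ((a + b + 2) * x - (a + 1)) * poly (pderiv q) x
    = real n * (real n + a + b + 1) * poly q x"
proof -
  have "[:0, -1, 1:] * pderiv (pderiv q) + [:- (a + 1), a + b + 2:] * pderiv q
      = smult (real n * (real n + a + b + 1)) q" (is "?l = ?r")
  proof (rule poly_eqI)
    fix i
    have rec: "coeff q (Suc i) * ((real i + 1) * (a + real i + 1)) =
       - (coeff q i * ((real n - real i) * (real n + a + b + 1 + real i)))"
      using jacobi_coeff_Suc[of n a b i] by (simp add: q_def coeff_jacobi_shifted)
    show "coeff ?l i = coeff ?r i"
    proof (cases i)
      case 0
      then show ?thesis
        using rec by (simp add: coeff_pderiv algebra_simps)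
    next
      case (Suc j)
      then show ?thesis
        using rec by (cases j) (auto simp: coeff_pderiv algebra_simps)
    qed
  qed
  then have "poly ?l x = poly ?r x" by simp
  then show ?thesis
    by (simp add: algebra_simps power2_eq_square)
qed

section \<open>The eigenvalue equation\<close>

text \<open>Counting only the powers of \<open>x + y - 1\<close> and \<open>1 - x\<close>, the first
  summand keeps the degree \<open>i + k\<close> and the second lowers it by one. The truncated
  exponents \<open>k - 1\<close> and \<open>i - 1\<close> are harmless because they stand next to
  the factors \<open>real k\<close> and \<open>real i\<close>.\<close>

lemma apk_operator_term:
  fixes q :: "real poly" and i k \<alpha> \<beta> \<gamma> :: nat and x y :: real
  defines "T \<equiv> \<lambda>(x, y). poly q x * (x + y - 1) ^ i * (1 - x) ^ k"
  shows "apk_operator \<alpha> \<beta> \<gamma> T (x, y) =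
     (x + y - 1) ^ i * (1 - x) ^ k *
       ((x\<^sup>2 - x) * poly (pderiv (pderiv q)) x
        + ((real \<gamma> + 1 + 2 * real (i + k)) * x - real \<alpha>) * poly (pderiv q) x
        + real (i + k) * (real (i + k) + real \<gamma>) * poly q x)
     - poly q x * (real k * (real k + 2 * real i + real \<gamma> - real \<alpha>) * (x + y - 1) ^ i * (1 - x) ^ (k - 1)
                 - real i * (real i + real \<gamma> - real \<alpha> - real \<beta>) * (x + y - 1) ^ (i - 1) * (1 - x) ^ k)"
proof -
  have px: "pd_x T = (\<lambda>(x, y). poly (pderiv q) x * (x + y - 1) ^ i * (1 - x) ^ k
      + poly q x * (real i * (x + y - 1) ^ (i - 1)) * (1 - x) ^ k
      - poly q x * (x + y - 1) ^ i * (real k * (1 - x) ^ (k - 1)))"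
    unfolding T_def pd_x_def
    by (auto intro!: ext DERIV_imp_deriv)
       (auto simp: algebra_simps intro!: derivative_eq_intros)
  have py: "pd_y T = (\<lambda>(x, y). poly q x * (real i * (x + y - 1) ^ (i - 1)) * (1 - x) ^ k)"
    unfolding T_def pd_y_def
    by (auto intro!: ext DERIV_imp_deriv)
       (auto simp: algebra_simps intro!: derivative_eq_intros)
  have pyy: "pd_y (pd_y T) (x, y) =
      poly q x * (real i * (real (i - 1) * (x + y - 1) ^ (i - 1 - 1))) * (1 - x) ^ k"
    unfolding py unfolding pd_y_def
    by (auto intro!: ext DERIV_imp_deriv)
       (auto simp: algebra_simps intro!: derivative_eq_intros)
  have pxy: "pd_x (pd_y T) (x, y) =
      poly (pderiv q) x * (real i * (x + y - 1) ^ (i - 1)) * (1 - x) ^ k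
      + poly q x * (real i * (real (i - 1) * (x + y - 1) ^ (i - 1 - 1))) * (1 - x) ^ k
      - poly q x * (real i * (x + y - 1) ^ (i - 1)) * (real k * (1 - x) ^ (k - 1))"
    unfolding py unfolding pd_x_def
    by (auto intro!: ext DERIV_imp_deriv)
       (auto simp: algebra_simps intro!: derivative_eq_intros)
  have pxx: "pd_x (pd_x T) (x, y) =
      poly (pderiv (pderiv q)) x * (x + y - 1) ^ i * (1 - x) ^ k
      + poly q x * (real i * (real (i - 1) * (x + y - 1) ^ (i - 1 - 1))) * (1 - x) ^ k
      + poly q x * (x + y - 1) ^ i * (real k * (real (k - 1) * (1 - x) ^ (k - 1 - 1)))
      + 2 * poly (pderiv q) x * (real i * (x + y - 1) ^ (i - 1)) * (1 - x) ^ k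
      - 2 * poly (pderiv q) x * (x + y - 1) ^ i * (real k * (1 - x) ^ (k - 1))
      - 2 * poly q x * (real i * (x + y - 1) ^ (i - 1)) * (real k * (1 - x) ^ (k - 1))"
    unfolding px unfolding pd_x_def
    by (auto intro!: ext DERIV_imp_deriv)
       (auto simp: algebra_simps intro!: derivative_eq_intros)
  \<comment> \<open>\<open>P\<^sub>j\<close>, \<open>Q\<^sub>j\<close> are the \<open>j\<close>-th derivatives of the two powers; the relations \<open>P\<close>, \<open>Q\<close> between them hold
    also for exponents \<open>0\<close> and \<open>1\<close>, where the subtractions truncate.\<close>
  define P0 P1 P2 where "P0 = (x + y - 1) ^ i" and "P1 = real i * (x + y - 1) ^ (i - 1)"
    and "P2 = real i * (real (i - 1) * (x + y - 1) ^ (i - 1 - 1))"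
  define Q0 Q1 Q2 where "Q0 = (1 - x) ^ k" and "Q1 = real k * (1 - x) ^ (k - 1)"
    and "Q2 = real k * (real (k - 1) * (1 - x) ^ (k - 1 - 1))"
  have rel: "real n * w ^ (n - 1) * w = real n * w ^ n"
    "w * (real n * (real (n - 1) * w ^ (n - 1 - 1))) = (real n - 1) * (real n * w ^ (n - 1))"
    for n and w :: real
    by (cases n; cases "n - 1"; simp)+
  have P: "P1 * (x + y - 1) = real i * P0" "(x + y - 1) * P2 = (real i - 1) * P1"
    and Q: "Q1 * (1 - x) = real k * Q0" "(1 - x) * Q2 = (real k - 1) * Q1"
    unfolding P0_def P1_def P2_def Q0_def Q1_def Q2_def by (rule rel)+
  \<comment> \<open>With the derivatives replaced by letters, this is an ideal membership problem
    with generators \<open>P\<close> and \<open>Q\<close>: \<open>g\<close>, \<open>g1\<close>,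
    \<open>g2\<close> stand for \<open>q\<close> and its first two derivatives, \<open>a\<close>,
    \<open>b\<close>, \<open>c\<close> for \<alpha>, \<beta>, \<gamma>.\<close>
  have alg: "(x\<^sup>2 - x) * (g2 * P0 * Q0 + g * P2 * Q0 + g * P0 * Q2 + 2 * g1 * P1 * Q0 - 2 * g1 * P0 * Q1 - 2 * g * P1 * Q1)
    + 2 * x * y * (g1 * P1 * Q0 + g * P2 * Q0 - g * P1 * Q1) + (y\<^sup>2 - y) * (g * P2 * Q0)
    + ((c + 1) * x - a) * (g1 * P0 * Q0 + g * P1 * Q0 - g * P0 * Q1) + ((c + 1) * y - b) * (g * P1 * Q0)
    = P0 * Q0 * ((x\<^sup>2 - x) * g2 + ((c + 1 + 2 * (real i + real k)) * x - a) * g1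
        + (real i + real k) * (real i + real k + c) * g)
      - g * ((real k + 2 * real i + c - a) * P0 * Q1 - (real i + c - a - b) * P1 * Q0)" for g g1 g2 a b c
    using P Q by algebra
  have "apk_operator \<alpha> \<beta> \<gamma> T (x, y) =
    (x\<^sup>2 - x) * (poly (pderiv (pderiv q)) x * P0 * Q0 + poly q x * P2 * Q0 + poly q x * P0 * Q2
      + 2 * poly (pderiv q) x * P1 * Q0 - 2 * poly (pderiv q) x * P0 * Q1 - 2 * poly q x * P1 * Q1)
    + 2 * x * y * (poly (pderiv q) x * P1 * Q0 + poly q x * P2 * Q0 - poly q x * P1 * Q1)
    + (y\<^sup>2 - y) * (poly q x * P2 * Q0)
    + ((real \<gamma> + 1) * x - real \<alpha>) * (poly (pderiv q) x * P0 * Q0 + poly q x * P1 * Q0 - poly q x * P0 * Q1)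
    + ((real \<gamma> + 1) * y - real \<beta>) * (poly q x * P1 * Q0)"
    unfolding apk_operator_def prod.case pyy pxy pxx
    unfolding px py prod.case P0_def P1_def P2_def Q0_def Q1_def Q2_def ..
  also note alg
  finally show ?thesis
    by (simp add: P0_def P1_def Q0_def Q1_def mult_ac)
qed

lemma apk_eq_sum:
  "apk \<alpha> \<beta> \<gamma> (m, l) (x, y) =
    (\<Sum>i\<le>l. jacobi_coeff l (real \<gamma> - real \<alpha> - real \<beta>) (real \<beta> - 1) i *
      (poly (jacobi_shifted m (real \<alpha> - 1) (real \<gamma> - real \<alpha> + 2 * real l)) x * (x + y - 1) ^ i * (1 - x) ^ (l - i)))"
proof -
  have "(2 * y - (1 - x) - (1 - x)) / 2 = x + y - 1"
    by (simp add: field_simps)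
  then show ?thesis
    unfolding apk_def prod.case homogenised_jacobi_poly poly_jacobi_shifted
    by (simp only: sum_distrib_left mult_ac)
qed

section \<open>Partial derivatives of polynomial functions on the plane\<close>

lemma pd_x_eqI:
  assumes "\<And>x y. ((\<lambda>s. g (s, y)) has_real_derivative h (x, y)) (at x)"
  shows "pd_x g = h"
  using assms by (auto simp: pd_x_def intro!: DERIV_imp_deriv)

lemma pd_y_eqI:
  assumes "\<And>x y. ((\<lambda>s. g (x, s)) has_real_derivative h (x, y)) (at y)"
  shows "pd_y g = h"
  using assms by (auto simp: pd_y_def intro!: DERIV_imp_deriv)

text \<open>\<open>pd_x\<close> is built on \<open>deriv\<close>, which obeys the usual rules only
  once differentiability is known. The induction therefore constructs a polynomial derivative
  \<open>h\<close>, which is identified with \<open>pd_x g\<close> afterwards.\<close>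

lemma real_polynomial_function_pd_x:
  assumes "real_polynomial_function g"
  shows "real_polynomial_function (pd_x g)"
    and "((\<lambda>s. g (s, y)) has_real_derivative pd_x g (x, y)) (at x)"
proof -
  have "\<exists>h. real_polynomial_function h \<and> (\<forall>x y. ((\<lambda>s. g (s, y)) has_real_derivative h (x, y)) (at x))"
    using assms
  proof (induction g rule: real_polynomial_function.induct)
    case (linear g)
    have "((\<lambda>s. g (s, y)) has_real_derivative g (1, 0)) (at x)" for x y
    proof -
      have "(\<lambda>s. g (s, y)) = (\<lambda>s. s * g (1, 0) + g (0, y))"
      proof
        fix s
        show "g (s, y) = s * g (1, 0) + g (0, y)"
          using linear_add[OF bounded_linear.linear[OF linear], of "(s, 0)" "(0, y)"]
            linear_scale[OF bounded_linear.linear[OF linear], of s "(1, 0)"] by simp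
      qed
      then show ?thesis
        by (simp only:) (auto intro!: derivative_eq_intros)
    qed
    then show ?case
      by (intro exI[of _ "\<lambda>z. g (1, 0)"] conjI allI real_polynomial_function.intros(2))
  next
    case (const c)
    then show ?case
      by (intro exI[of _ "\<lambda>z. 0"] conjI allI real_polynomial_function.intros(2) DERIV_const)
  next
    case (add g1 g2)
    then obtain h1 h2 where "real_polynomial_function h1" "real_polynomial_function h2"
      "\<And>x y. ((\<lambda>s. g1 (s, y)) has_real_derivative h1 (x, y)) (at x)"
      "\<And>x y. ((\<lambda>s. g2 (s, y)) has_real_derivative h2 (x, y)) (at x)" by metis
    then show ?case
      by (intro exI[of _ "\<lambda>z. h1 z + h2 z"] conjI allI real_polynomial_function.intros(3) DERIV_add)
  next
    case (mult g1 g2)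
    then obtain h1 h2 where "real_polynomial_function h1" "real_polynomial_function h2"
      "\<And>x y. ((\<lambda>s. g1 (s, y)) has_real_derivative h1 (x, y)) (at x)"
      "\<And>x y. ((\<lambda>s. g2 (s, y)) has_real_derivative h2 (x, y)) (at x)" by metis
    with mult.hyps show ?case
      by (intro exI[of _ "\<lambda>z. h1 z * g2 z + h2 z * g1 z"] conjI allI
          real_polynomial_function.intros(3) real_polynomial_function.intros(4) DERIV_mult)
  qed
  then obtain h where h: "real_polynomial_function h"
    "\<And>x y. ((\<lambda>s. g (s, y)) has_real_derivative h (x, y)) (at x)" by blast
  moreover from h(2) have "pd_x g = h" by (rule pd_x_eqI)
  ultimately show "real_polynomial_function (pd_x g)"
    and "((\<lambda>s. g (s, y)) has_real_derivative pd_x g (x, y)) (at x)" by simp_all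
qed

text \<open>Swapping the coordinates transfers the facts about \<open>pd_x\<close> to
  \<open>pd_y\<close> and saves a second induction.\<close>

lemma pd_y_eq_pd_x_swap: "pd_y g = pd_x (g \<circ> prod.swap) \<circ> prod.swap"
  by (auto simp: pd_x_def pd_y_def)

lemma real_polynomial_function_swap:
  assumes "real_polynomial_function g"
  shows "real_polynomial_function (g \<circ> (prod.swap :: real \<times> real \<Rightarrow> _))"
proof (rule real_polynomial_function_compose[OF _ assms])
  have "bounded_linear (\<lambda>z :: real \<times> real. (snd z, fst z))"
    by (intro bounded_linear_Pair bounded_linear_fst bounded_linear_snd)
  moreover have "prod.swap = (\<lambda>z :: real \<times> real. (snd z, fst z))"
    by (simp add: fun_eq_iff prod.swap_def)
  ultimately show "polynomial_function (prod.swap :: real \<times> real \<Rightarrow> _)"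
    by (simp only: polynomial_function_bounded_linear)
qed

lemma real_polynomial_function_pd_y:
  assumes "real_polynomial_function g"
  shows "real_polynomial_function (pd_y g)"
    and "((\<lambda>s. g (x, s)) has_real_derivative pd_y g (x, y)) (at y)"
  using real_polynomial_function_pd_x[OF real_polynomial_function_swap[OF assms]]
  by (auto simp: pd_y_eq_pd_x_swap intro: real_polynomial_function_swap)

lemma pd_x_sum:
  assumes "\<And>k. k \<in> K \<Longrightarrow> real_polynomial_function (g k)"
  shows "pd_x (\<lambda>z. \<Sum>k\<in>K. c k * g k z) = (\<lambda>z. \<Sum>k\<in>K. c k * pd_x (g k) z)"
  using assms by (intro pd_x_eqI DERIV_sum DERIV_cmult real_polynomial_function_pd_x)

lemma pd_y_sum:
  assumes "\<And>k. k \<in> K \<Longrightarrow> real_polynomial_function (g k)"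
  shows "pd_y (\<lambda>z. \<Sum>k\<in>K. c k * g k z) = (\<lambda>z. \<Sum>k\<in>K. c k * pd_y (g k) z)"
  using assms by (intro pd_y_eqI DERIV_sum DERIV_cmult real_polynomial_function_pd_y)

text \<open>Partial derivatives of polynomial functions are again polynomial functions, so
  \<open>deriv\<close> acts linearly at both orders.\<close>

lemma apk_operator_sum:
  assumes "\<And>k. k \<in> K \<Longrightarrow> real_polynomial_function (g k)"
  shows "apk_operator \<alpha> \<beta> \<gamma> (\<lambda>z. \<Sum>k\<in>K. c k * g k z) = (\<lambda>z. \<Sum>k\<in>K. c k * apk_operator \<alpha> \<beta> \<gamma> (g k) z)"
  by (auto simp: apk_operator_def pd_x_sum pd_y_sum real_polynomial_function_pd_x(1)
      real_polynomial_function_pd_y(1) assms sum_distrib_left sum.distrib sum_subtractf algebra_simps)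

lemma real_polynomial_function_term:
  "real_polynomial_function (\<lambda>(x, y). poly q x * (x + y - 1) ^ i * (1 - x) ^ k)"
proof -
  have "real_polynomial_function (\<lambda>z :: real \<times> real. fst z)" "real_polynomial_function (\<lambda>z :: real \<times> real. snd z)"
    by (intro real_polynomial_function.intros(1) bounded_linear_fst bounded_linear_snd)+
  then show ?thesis
    unfolding split_def poly_altdef
    by (intro real_polynomial_function_sum real_polynomial_function.intros(4) real_polynomial_function_power
        real_polynomial_function_diff real_polynomial_function.intros(3) real_polynomial_function.intros(2)) auto
qed

lemma apk_eq_term_sum:
  "apk \<alpha> \<beta> \<gamma> (m, l) = (\<lambda>z. \<Sum>i\<le>l. jacobi_coeff l (real \<gamma> - real \<alpha> - real \<beta>) (real \<beta> - 1) i *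
      (\<lambda>(x, y). poly (jacobi_shifted m (real \<alpha> - 1) (real \<gamma> - real \<alpha> + 2 * real l)) x
         * (x + y - 1) ^ i * (1 - x) ^ (l - i)) z)"
  by (auto simp: apk_eq_sum)

lemma real_polynomial_function_apk: "real_polynomial_function (apk \<alpha> \<beta> \<gamma> k)"
proof (cases k)
  case (Pair m l)
  show ?thesis
    unfolding Pair apk_eq_term_sum
    by (intro real_polynomial_function_sum real_polynomial_function.intros(4)
        real_polynomial_function.intros(2) real_polynomial_function_term) simp
qed

lemma apk_operator_apk:
  "apk_operator \<alpha> \<beta> \<gamma> (apk \<alpha> \<beta> \<gamma> k) z = apk_eigenvalue \<gamma> k * apk \<alpha> \<beta> \<gamma> k z"
proof -
  obtain m l where k: "k = (m, l)" by force
  obtain x y where z: "z = (x, y)" by force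
  define q where "q = jacobi_shifted m (real \<alpha> - 1) (real \<gamma> - real \<alpha> + 2 * real l)"
  define a where "a = jacobi_coeff l (real \<gamma> - real \<alpha> - real \<beta>) (real \<beta> - 1)"
  define w v where "w = x + y - 1" and "v = 1 - x"
  \<comment> \<open>Up to the factor \<open>poly q x\<close>, \<open>F i\<close> is the part of term
    \<open>i\<close> in degree \<open>l - 1\<close> with the exponent of \<open>w\<close> lowered;
    by the recurrence, \<open>F (Suc i)\<close> is the part with the exponent of \<open>v\<close>
    lowered.\<close>
  define F where "F i = a i * (real i * (real i + real \<gamma> - real \<alpha> - real \<beta>) * w ^ (i - 1) * v ^ (l - i))" for i
  \<comment> \<open>The Jacobi eigenvalue for these parameters is
    \<open>m * (m + 2 * l + \<gamma>)\<close>; adding \<open>l * (l + \<gamma>)\<close> gives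
    \<open>(m + l) * (m + l + \<gamma>)\<close>.\<close>
  have ode: "(x\<^sup>2 - x) * poly (pderiv (pderiv q)) x
      + ((real \<gamma> + 1 + 2 * real l) * x - real \<alpha>) * poly (pderiv q) x
      + real l * (real l + real \<gamma>) * poly q x = apk_eigenvalue \<gamma> k * poly q x"
    using jacobi_shifted_ode[of x m "real \<alpha> - 1" "real \<gamma> - real \<alpha> + 2 * real l"]
    by (simp add: q_def k apk_eigenvalue_def algebra_simps)
  have step: "a i * apk_operator \<alpha> \<beta> \<gamma> (\<lambda>(x, y). poly q x * (x + y - 1) ^ i * (1 - x) ^ (l - i)) z
      = apk_eigenvalue \<gamma> k * (a i * (poly q x * w ^ i * v ^ (l - i))) - poly q x * (F (Suc i) - F i)"
    if "i \<le> l" for i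
  proof -
    have "a (Suc i) * ((real i + 1) * (real i + 1 + real \<gamma> - real \<alpha> - real \<beta>))
        = a i * (real (l - i) * (real (l - i) + 2 * real i + real \<gamma> - real \<alpha>))"
      using jacobi_coeff_Suc[of l "real \<gamma> - real \<alpha> - real \<beta>" "real \<beta> - 1" i] that
      by (simp add: a_def algebra_simps of_nat_diff)
    then have FS: "F (Suc i) = a i * (real (l - i) * (real (l - i) + 2 * real i + real \<gamma> - real \<alpha>)) * w ^ i * v ^ (l - i - 1)"
      by (simp add: F_def add_ac flip: mult.assoc)
    have "apk_operator \<alpha> \<beta> \<gamma> (\<lambda>(x, y). poly q x * (x + y - 1) ^ i * (1 - x) ^ (l - i)) z
      = w ^ i * v ^ (l - i) * (apk_eigenvalue \<gamma> k * poly q x)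
        - poly q x * (real (l - i) * (real (l - i) + 2 * real i + real \<gamma> - real \<alpha>) * w ^ i * v ^ (l - i - 1)
          - real i * (real i + real \<gamma> - real \<alpha> - real \<beta>) * w ^ (i - 1) * v ^ (l - i))"
      using that unfolding z apk_operator_term ode[symmetric] w_def v_def by simp
    then show ?thesis
      unfolding FS unfolding F_def by (simp only:) (simp only: algebra_simps)
  qed
  have "apk_operator \<alpha> \<beta> \<gamma> (apk \<alpha> \<beta> \<gamma> k) z
      = (\<Sum>i\<le>l. apk_eigenvalue \<gamma> k * (a i * (poly q x * w ^ i * v ^ (l - i))) - poly q x * (F (Suc i) - F i))"
    unfolding k apk_eq_term_sum apk_operator_sum[OF real_polynomial_function_term]
    unfolding k[symmetric] a_def[symmetric] q_def[symmetric]
    by (intro sum.cong step) auto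
  also have "\<dots> = apk_eigenvalue \<gamma> k * apk \<alpha> \<beta> \<gamma> k z - poly q x * (\<Sum>i<Suc l. F (Suc i) - F i)"
    unfolding k z apk_eq_sum
    by (simp add: sum_subtractf right_diff_distrib sum_distrib_left a_def q_def w_def v_def lessThan_Suc_atMost)
  \<comment> \<open>\<open>F 0\<close> vanishes by its factor \<open>real 0\<close>, and
    \<open>F (Suc l)\<close> because \<open>jacobi_coeff\<close> is \<open>0\<close> beyond the
    index \<open>l\<close>.\<close>
  also have "(\<Sum>i<Suc l. F (Suc i) - F i) = 0"
    unfolding sum_lessThan_telescope by (simp add: F_def a_def jacobi_coeff_def)
  finally show ?thesis by simp
qed

section \<open>Linear independence on the triangle\<close>

text \<open>A combination with infinitely many roots is the zero polynomial. Its coefficient at the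
  top degree comes from the last member alone, which can therefore be split off.\<close>

lemma graded_polys_independent:
  fixes q :: "nat \<Rightarrow> real poly"
  assumes deg: "\<And>l. l \<le> n \<Longrightarrow> degree (q l) = l" and nz: "\<And>l. l \<le> n \<Longrightarrow> q l \<noteq> 0"
    and S: "infinite S" and zero: "\<And>s. s \<in> S \<Longrightarrow> (\<Sum>l\<le>n. d l * poly (q l) s) = 0"
    and l: "l \<le> n"
  shows "d l = 0"
  using deg nz zero l
proof (induction n arbitrary: l)
  case 0
  obtain s where "s \<in> S" using S by fastforce
  moreover obtain a where "q 0 = [:a:]"
    using 0(1)[of 0] degree_eq_zeroE by blast
  ultimately show ?case
    using 0(2)[of 0] 0(3)[of s] 0(4) by auto
next
  case (Suc n)
  define r where "r = (\<Sum>l\<le>Suc n. smult (d l) (q l))"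
  have "S \<subseteq> {s. poly r s = 0}"
    using Suc.prems(3) by (auto simp: r_def poly_sum)
  then have "r = 0"
    using S poly_roots_finite[of r] finite_subset by blast
  moreover have "coeff r (Suc n) = d (Suc n) * coeff (q (Suc n)) (Suc n)"
    using Suc.prems(1) by (simp add: r_def coeff_sum coeff_eq_0)
  moreover have "coeff (q (Suc n)) (Suc n) \<noteq> 0"
    using Suc.prems(1,2)[of "Suc n"] leading_coeff_0_iff[of "q (Suc n)"] by simp
  ultimately have top: "d (Suc n) = 0" by simp
  show ?case
  proof (cases "l = Suc n")
    case False
    show ?thesis
    proof (rule Suc.IH)
      show "(\<Sum>l\<le>n. d l * poly (q l) s) = 0" if "s \<in> S" for s
        using Suc.prems(3)[OF that] top by simp
    qed (use Suc.prems False in auto)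
  qed (simp add: top)
qed

lemma jacobi_poly_nonzero:
  assumes "0 \<le> a" "0 \<le> b"
  shows "jacobi_poly n a b \<noteq> 0"
  using coeff_jacobi_poly_top[of n a b] jacobi_coeff_top_nonzero[OF assms, of n] by auto

text \<open>For fixed \<open>l\<close> the APK polynomials share the factor containing
  \<open>y\<close>, so with \<open>l\<close> outside the inner sums reduce to combinations of
  polynomials in \<open>x\<close>.\<close>

lemma sum_apk_index:
  fixes g :: "nat \<times> nat \<Rightarrow> real"
  shows "(\<Sum>k\<in>apk_index N. g k) = (\<Sum>l\<le>N. \<Sum>m\<le>N - l. g (m, l))"
proof -
  have "apk_index N = prod.swap ` Sigma {..N} (\<lambda>l. {..N - l})"
    by (force simp: apk_index_def)
  then have "(\<Sum>k\<in>apk_index N. g k) = (\<Sum>z\<in>Sigma {..N} (\<lambda>l. {..N - l}). g (prod.swap z))"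
    by (simp add: sum.reindex)
  then show ?thesis
    by (simp add: sum.Sigma case_prod_beta prod.swap_def)
qed

lemma finite_apk_index: "finite (apk_index N)"
  by (rule finite_subset[of _ "{..N} \<times> {..N}"]) (auto simp: apk_index_def)

text \<open>On a vertical segment with fixed \<open>x < 1\<close>, an APK polynomial is a multiple
  of a polynomial of degree \<open>l\<close> in \<open>s = 2 * y / (1 - x) - 1\<close>. Independence
  in \<open>s\<close> isolates each \<open>l\<close>; varying \<open>x\<close> then isolates
  \<open>m\<close>.\<close>

lemma apk_independent:
  assumes "1 \<le> \<alpha>" "1 \<le> \<beta>" "\<alpha> + \<beta> - 1 < \<gamma>"
    and zero: "\<And>z. z \<in> triangle \<Longrightarrow> expansion (apk \<alpha> \<beta> \<gamma>) (apk_index N) c z = 0"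
    and k: "k \<in> apk_index N"
  shows "c k = 0"
proof -
  obtain m l where ml: "k = (m, l)" "m \<le> N - l" "l \<le> N"
    using k by (auto simp: apk_index_def)
  \<comment> \<open>For natural parameters the strict inequality means
    \<open>\<alpha> + \<beta> \<le> \<gamma>\<close>. Nonnegative Jacobi parameters ensure nonzero
    leading coefficients.\<close>
  have par: "0 \<le> real \<alpha> - 1" "0 \<le> real \<gamma> - real \<alpha> - real \<beta>" "0 \<le> real \<beta> - 1"
    "0 \<le> real \<gamma> - real \<alpha> + 2 * real l'" for l'
    using assms(1-3) by auto
  define J where "J m l = jacobi_poly m (real \<alpha> - 1) (real \<gamma> - real \<alpha> + 2 * real l)" for m l
  define q where "q l = jacobi_poly l (real \<gamma> - real \<alpha> - real \<beta>) (real \<beta> - 1)" for l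
  have inner: "(\<Sum>m\<le>N - l. c (m, l) * poly (J m l) (1 - 2 * x)) = 0" if x: "0 \<le> x" "x < 1" for x
  proof -
    have "(\<Sum>m\<le>N - l. c (m, l) * poly (J m l) (1 - 2 * x)) * (1 - x) ^ l = 0"
    proof (rule graded_polys_independent[of N q "{-1..1}"])
      fix s :: real assume s: "s \<in> {-1..1}"
      \<comment> \<open>The inverse of \<open>y \<mapsto> 2 * y / (1 - x) - 1\<close>; it maps
        \<open>{-1..1}\<close> onto the segment \<open>{0..1 - x}\<close>.\<close>
      define y where "y = (1 - x) * ((s + 1) / 2)"
      have "2 * y / (1 - x) - 1 = s"
        using x by (simp add: y_def)
      moreover have "(1 - x) * ((s + 1) / 2) \<le> (1 - x) * 1"
        using s x by (intro mult_left_mono) auto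
      then have "(x, y) \<in> triangle"
        using s x by (simp add: triangle_def y_def)
      ultimately show "(\<Sum>l\<le>N. (\<Sum>m\<le>N - l. c (m, l) * poly (J m l) (1 - 2 * x)) * (1 - x) ^ l * poly (q l) s) = 0"
        using zero[of "(x, y)"] x
        by (simp add: expansion_def sum_apk_index apk_eq J_def q_def sum_distrib_left sum_distrib_right mult_ac)
    qed (use ml par in \<open>auto simp: q_def degree_jacobi_poly jacobi_poly_nonzero\<close>)
    then show ?thesis using x by simp
  qed
  have "c (m, l) = 0"
  proof (rule graded_polys_independent[of "N - l" "\<lambda>m. J m l" "{-1<..<1}" "\<lambda>m. c (m, l)"])
    show "(\<Sum>m\<le>N - l. c (m, l) * poly (J m l) r) = 0" if "r \<in> {-1<..<1}" for r
    proof -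
      have "1 - 2 * ((1 - r) / 2) = r" by (simp add: field_simps)
      with inner[of "(1 - r) / 2"] that show ?thesis by simp
    qed
  qed (use ml par in \<open>auto simp: J_def degree_jacobi_poly jacobi_poly_nonzero\<close>)
  with ml show ?thesis by simp
qed

section \<open>The viscous sub-step\<close>

text \<open>Each application of \<open>- D\<close> stays in the span and multiplies the coefficients
  by \<open>- ev k\<close>. The resulting sign \<open>(-1) ^ p\<close> and the prefactor
  \<open>(-1) ^ (p + 1)\<close> combine to \<open>-1\<close>.\<close>

lemma viscosity_rhs_expansion:
  assumes "\<And>c. D (expansion \<phi> I c) = expansion \<phi> I (\<lambda>k. ev k * c k)"
  shows "viscosity_rhs D \<epsilon> p (expansion \<phi> I c) = expansion \<phi> I (\<lambda>k. - (\<epsilon> * ev k ^ p) * c k)"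
proof -
  have "((\<lambda>g w. - D g w) ^^ p) (expansion \<phi> I c) = expansion \<phi> I (\<lambda>k. (- ev k) ^ p * c k)"
  proof (induction p)
    case (Suc p)
    then show ?case
      by (simp add: assms) (simp add: expansion_def sum_negf mult_ac)
  qed simp
  then show ?thesis
    by (simp add: viscosity_rhs_def expansion_def sum_distrib_left mult_ac power_minus[of "ev _"])
qed

text \<open>Gaussian elimination on the index set, pivoting on a point where the new function does not vanish.\<close>

lemma coefficients_in_subspace:
  fixes \<phi> :: "'k \<Rightarrow> 'z \<Rightarrow> real" and W :: "('t \<Rightarrow> real) set"
  assumes "finite I"
    and subspace: "\<And>a b g h. g \<in> W \<Longrightarrow> h \<in> W \<Longrightarrow> (\<lambda>t. a * g t + b * h t) \<in> W"
    and "\<And>d k. (\<And>z. z \<in> S \<Longrightarrow> (\<Sum>k\<in>I. d k * \<phi> k z) = 0) \<Longrightarrow> k \<in> I \<Longrightarrow> d k = 0"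
    and "\<And>z. z \<in> S \<Longrightarrow> (\<lambda>t. \<Sum>k\<in>I. c t k * \<phi> k z) \<in> W"
    and "k \<in> I"
  shows "(\<lambda>t. c t k) \<in> W"
  using assms(1,3-)
proof (induction I arbitrary: \<phi> k rule: finite_induct)
  case (insert j I)
  note indep = insert.prems(1) and mem = insert.prems(2)
  \<comment> \<open>Otherwise the coefficient vector with a single \<open>1\<close> at
    \<open>j\<close> would contradict independence.\<close>
  have "\<exists>z\<in>S. \<phi> j z \<noteq> 0"
  proof (rule ccontr)
    assume "\<not> ?thesis"
    then have "(\<Sum>k\<in>insert j I. (if k = j then 1 else 0) * \<phi> k z) = 0" if "z \<in> S" for z
      using that insert.hyps by (auto intro!: sum.neutral)
    from indep[OF this, of j] show False by simp
  qed
  then obtain z0 where z0: "z0 \<in> S" "\<phi> j z0 \<noteq> 0" by blast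
  define \<psi> where "\<psi> k z = \<phi> k z - \<phi> k z0 / \<phi> j z0 * \<phi> j z" for k z
  have \<psi>: "(\<Sum>k\<in>I. d k * \<psi> k z)
      = (\<Sum>k\<in>I. d k * \<phi> k z) - (\<Sum>k\<in>I. d k * \<phi> k z0) / \<phi> j z0 * \<phi> j z" for d z
    by (simp add: \<psi>_def sum_subtractf right_diff_distrib sum_distrib_left sum_distrib_right sum_divide_distrib mult_ac)
  have in_I: "(\<lambda>t. c t k) \<in> W" if "k \<in> I" for k
  proof (rule insert.IH[of \<psi>])
    fix d i assume z: "\<And>z. z \<in> S \<Longrightarrow> (\<Sum>k\<in>I. d k * \<psi> k z) = 0" and i: "i \<in> I"
    \<comment> \<open>The entry at \<open>j\<close> collects the multiples of
      \<open>\<phi> j\<close> contained in the \<open>\<psi> k\<close>, so a relation among the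
      \<open>\<psi> k\<close> becomes one among the \<open>\<phi> k\<close>.\<close>
    define e where "e = d(j := - (\<Sum>k\<in>I. d k * \<phi> k z0) / \<phi> j z0)"
    have "(\<Sum>k\<in>I. e k * \<phi> k z) = (\<Sum>k\<in>I. d k * \<phi> k z)" for z
      using insert.hyps by (intro sum.cong) (auto simp: e_def)
    then have "(\<Sum>k\<in>insert j I. e k * \<phi> k z) = 0" if "z \<in> S" for z
      using insert.hyps z[OF that] unfolding \<psi> by (simp add: e_def)
    from indep[OF this, of i] i insert.hyps show "d i = 0" by (auto simp: e_def split: if_splits)
  next
    fix z assume z: "z \<in> S"
    have "(\<lambda>t. \<Sum>k\<in>I. c t k * \<psi> k z) = (\<lambda>t. 1 * (\<Sum>k\<in>insert j I. c t k * \<phi> k z)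
        + (- \<phi> j z / \<phi> j z0) * (\<Sum>k\<in>insert j I. c t k * \<phi> k z0))"
      using insert.hyps z0 unfolding \<psi> by (auto simp: field_simps)
    then show "(\<lambda>t. \<Sum>k\<in>I. c t k * \<psi> k z) \<in> W"
      using subspace[OF mem[OF z] mem[OF z0(1)], of 1 "- \<phi> j z / \<phi> j z0"] by simp
  qed (fact that)
  have sums: "(\<lambda>t. \<Sum>k\<in>J. c t k * \<phi> k z0) \<in> W" if "J \<subseteq> I" for J
    using finite_subset[OF that insert.hyps(1)] that
  proof (induction J rule: finite_induct)
    case empty
    then show ?case using subspace[OF mem mem, OF z0(1) z0(1), of 0 0] by simp
  next
    case (insert i J)
    then show ?case using subspace[OF in_I[of i], of _ "\<phi> i z0" 1] by (simp add: mult.commute)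
  qed
  \<comment> \<open>Back substitution: subtract the contribution of \<open>I\<close> from the value
    at \<open>z0\<close> and divide by the pivot.\<close>
  have "(\<lambda>t. c t j) = (\<lambda>t. 1 / \<phi> j z0 * (\<Sum>k\<in>insert j I. c t k * \<phi> k z0)
      + (- 1 / \<phi> j z0) * (\<Sum>k\<in>I. c t k * \<phi> k z0))"
    using insert.hyps z0 by (auto simp: field_simps)
  then have "(\<lambda>t. c t j) \<in> W"
    using subspace[OF mem[OF z0(1)] sums[OF order_refl], of "1 / \<phi> j z0" "- 1 / \<phi> j z0"] by simp
  with in_I insert.prems(3) show ?case by blast
qed simp

text \<open>\<open>exp (- (a * t))\<close> is an integrating factor: its product with
  \<open>g\<close> has derivative zero on the interval and is constant there.\<close>

lemma exponential_ode_unique: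
  fixes g :: "real \<Rightarrow> real"
  assumes "t0 \<le> t1"
    and "\<And>t. t \<in> {t0..t1} \<Longrightarrow> (g has_real_derivative a * g t) (at t within {t0..t1})"
  shows "g t1 = exp (a * (t1 - t0)) * g t0"
proof -
  have "((\<lambda>t. exp (- (a * t)) * g t) has_real_derivative 0) (at t within {t0..t1})" if "t \<in> {t0..t1}" for t
    by (rule derivative_eq_intros assms(2)[OF that] refl | simp)+
  then obtain C where "\<And>t. t \<in> {t0..t1} \<Longrightarrow> exp (- (a * t)) * g t = C"
    using has_field_derivative_zero_constant[of "{t0..t1}" "\<lambda>t. exp (- (a * t)) * g t"] by auto
  then have "exp (- (a * t1)) * g t1 = exp (- (a * t0)) * g t0"
    using assms(1) by simp
  then show ?thesis
    by (simp add: exp_minus exp_diff right_diff_distrib field_simps)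
qed

text \<open>\<open>solves_on\<close> speaks only of point values, so differentiability of the
  coefficients has to be derived first. Then the two expressions for the time derivative of the
  expansion agree on the triangle, and independence compares their coefficients.\<close>

lemma solves_on_diagonal_iff:
  assumes "finite I" and "t0 < t1"
    and indep: "\<And>d k. (\<And>z. z \<in> triangle \<Longrightarrow> expansion \<phi> I d z = 0) \<Longrightarrow> k \<in> I \<Longrightarrow> d k = 0"
    and R: "\<And>c. R (expansion \<phi> I c) = expansion \<phi> I (\<lambda>k. a k * c k)"
  shows "solves_on \<phi> I R t0 t1 c \<longleftrightarrow>
    (\<forall>k\<in>I. \<forall>t\<in>{t0..t1}. ((\<lambda>s. c s k) has_real_derivative a k * c t k) (at t within {t0..t1}))"
proof
  assume sol: "solves_on \<phi> I R t0 t1 c"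
  show "\<forall>k\<in>I. \<forall>t\<in>{t0..t1}. ((\<lambda>s. c s k) has_real_derivative a k * c t k) (at t within {t0..t1})"
  proof (intro ballI)
    fix k t assume k: "k \<in> I" and t: "t \<in> {t0..t1}"
    let ?F = "at t within {t0..t1}"
    have "\<exists>d. ((\<lambda>s. c s i) has_real_derivative d) ?F" if "i \<in> I" for i
    proof -
      have "(\<lambda>s. c s i) \<in> {g. \<exists>d. (g has_real_derivative d) ?F}"
      proof (rule coefficients_in_subspace[OF assms(1), where \<phi> = \<phi> and S = triangle])
        show "(\<lambda>s. \<Sum>i\<in>I. c s i * \<phi> i z) \<in> {g. \<exists>d. (g has_real_derivative d) ?F}" if "z \<in> triangle" for z
          using sol t that unfolding solves_on_def expansion_def by blast
      next
        fix b b' g h assume "g \<in> {g. \<exists>d. (g has_real_derivative d) ?F}" "h \<in> {g. \<exists>d. (g has_real_derivative d) ?F}"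
        then obtain dg dh where "(g has_real_derivative dg) ?F" "(h has_real_derivative dh) ?F"
          by blast
        then have "((\<lambda>t. b * g t + b' * h t) has_real_derivative b * dg + b' * dh) ?F"
          by (intro DERIV_add DERIV_cmult)
        then show "(\<lambda>t. b * g t + b' * h t) \<in> {g. \<exists>d. (g has_real_derivative d) ?F}"
          by blast
      qed (use indep that in \<open>auto simp: expansion_def\<close>)
      then show ?thesis by simp
    qed
    then obtain d where d: "\<And>i. i \<in> I \<Longrightarrow> ((\<lambda>s. c s i) has_real_derivative d i) ?F"
      by metis
    have "d k - a k * c t k = 0"
    proof (rule indep[OF _ k])
      fix z assume z: "z \<in> triangle"
      have "((\<lambda>s. expansion \<phi> I (c s) z) has_real_derivative expansion \<phi> I d z) ?F"
        unfolding expansion_def by (intro DERIV_sum DERIV_cmult_right d)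
      moreover have "((\<lambda>s. expansion \<phi> I (c s) z) has_real_derivative expansion \<phi> I (\<lambda>i. a i * c t i) z) ?F"
        using sol z t by (simp add: solves_on_def R)
      \<comment> \<open>By \<open>t0 < t1\<close> every point of the interval, endpoints included,
        is a limit point, so the derivative within it is unique.\<close>
      moreover have "?F \<noteq> bot"
        using assms(2) t by (simp add: trivial_limit_within islimpt_Icc)
      ultimately have "expansion \<phi> I d z = expansion \<phi> I (\<lambda>i. a i * c t i) z"
        by (rule has_field_derivative_unique)
      then show "expansion \<phi> I (\<lambda>i. d i - a i * c t i) z = 0"
        by (simp add: expansion_def left_diff_distrib sum_subtractf)
    qed
    with d[OF k] show "((\<lambda>s. c s k) has_real_derivative a k * c t k) ?F" by simp
  qed
next
  assume "\<forall>k\<in>I. \<forall>t\<in>{t0..t1}. ((\<lambda>s. c s k) has_real_derivative a k * c t k) (at t within {t0..t1})"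
  then show "solves_on \<phi> I R t0 t1 c"
    unfolding solves_on_def R unfolding expansion_def by (intro ballI DERIV_sum DERIV_cmult_right) auto
qed

section \<open>Splitting as multiplication of coefficients\<close>

theorem theorem4p2:
  fixes \<alpha> \<beta> \<gamma> N p :: nat and \<epsilon> \<Delta>t :: real
    and f :: "real \<Rightarrow> real \<times> real"
    and X :: "plane_fun set" and P :: "plane_fun \<Rightarrow> plane_fun"
    and \<phi> :: "nat \<times> nat \<Rightarrow> plane_fun" and I :: "(nat \<times> nat) set"
    and V :: "plane_fun \<Rightarrow> plane_fun" and \<sigma> :: "nat \<times> nat \<Rightarrow> real"
  defines "\<phi> \<equiv> apk \<alpha> \<beta> \<gamma>"
    and "I \<equiv> apk_index N"
    and "V \<equiv> viscosity_rhs (apk_operator \<alpha> \<beta> \<gamma>) \<epsilon> p"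
    and "\<sigma> \<equiv> \<lambda>k. exp (- \<epsilon> * \<Delta>t * apk_eigenvalue \<gamma> k ^ p)"
  assumes "1 \<le> \<alpha>" and "1 \<le> \<beta>" and "1 \<le> \<gamma>" and "\<alpha> + \<beta> - 1 < \<gamma>"
    and "1 \<le> N" and "1 \<le> p" and "0 < \<epsilon>" and "0 < \<Delta>t"
    and "projection_onto X (span_of \<phi> I) P"
    and "\<And>u. u \<in> span_of \<phi> I \<Longrightarrow> (\<lambda>z. fst (f (u z))) \<in> X \<and> (\<lambda>z. snd (f (u z))) \<in> X"
  shows "(\<forall>t c0. \<exists>c. solves_on \<phi> I V t (t + \<Delta>t) c \<and> (\<forall>k\<in>I. c t k = c0 k)) \<and>
    (\<forall>t c. solves_on \<phi> I V t (t + \<Delta>t) c \<longrightarrow> (\<forall>k\<in>I. c (t + \<Delta>t) k = \<sigma> k * c t k)) \<and>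
    (\<forall>first u. splitting_method \<phi> I first (exact_step \<phi> I) (conservation_rhs P f) V \<Delta>t u \<longleftrightarrow>
               filtered_method \<phi> I first (exact_step \<phi> I) (conservation_rhs P f) \<sigma> \<Delta>t u) \<and>
    (\<forall>first integrator u. splitting_method \<phi> I first integrator (conservation_rhs P f) V \<Delta>t u \<longleftrightarrow>
                      filtered_method \<phi> I first integrator (conservation_rhs P f) \<sigma> \<Delta>t u)"
proof -
  define a where "a k = - (\<epsilon> * apk_eigenvalue \<gamma> k ^ p)" for k
  have "apk_operator \<alpha> \<beta> \<gamma> (expansion \<phi> I d) = expansion \<phi> I (\<lambda>k. apk_eigenvalue \<gamma> k * d k)" for d
    by (simp add: expansion_def \<phi>_def apk_operator_sum real_polynomial_function_apk apk_operator_apk mult_ac)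
  then have V: "V (expansion \<phi> I d) = expansion \<phi> I (\<lambda>k. a k * d k)" for d
    unfolding V_def a_def by (rule viscosity_rhs_expansion)
  have sol_iff: "solves_on \<phi> I V t (t + \<Delta>t) c \<longleftrightarrow>
    (\<forall>k\<in>I. \<forall>s\<in>{t..t + \<Delta>t}. ((\<lambda>s. c s k) has_real_derivative a k * c s k) (at s within {t..t + \<Delta>t}))" for t c
  proof (rule solves_on_diagonal_iff[OF _ _ _ V])
    show "d k = 0" if "\<And>z. z \<in> triangle \<Longrightarrow> expansion \<phi> I d z = 0" "k \<in> I" for d k
      using apk_independent[OF \<open>1 \<le> \<alpha>\<close> \<open>1 \<le> \<beta>\<close> \<open>\<alpha> + \<beta> - 1 < \<gamma>\<close>, of N d k] that
      unfolding \<phi>_def I_def by blast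
  qed (use \<open>0 < \<Delta>t\<close> in \<open>auto simp: I_def finite_apk_index\<close>)
  have exist: "\<exists>c. solves_on \<phi> I V t (t + \<Delta>t) c \<and> (\<forall>k\<in>I. c t k = c0 k)" for t c0
    unfolding sol_iff
    by (rule exI[of _ "\<lambda>s k. exp (a k * (s - t)) * c0 k"])
       (auto intro!: derivative_eq_intros)
  have unique: "c (t + \<Delta>t) k = \<sigma> k * c t k" if "solves_on \<phi> I V t (t + \<Delta>t) c" "k \<in> I" for t c k
    using exponential_ode_unique[of t "t + \<Delta>t" "\<lambda>s. c s k" "a k"] that \<open>0 < \<Delta>t\<close>
    unfolding sol_iff by (simp add: \<sigma>_def a_def mult_ac)
  \<comment> \<open>Initial data and solutions are controlled only on \<open>I\<close>, and an
    expansion depends on nothing else.\<close>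
  have cong: "expansion \<phi> I d = expansion \<phi> I e" if "\<And>k. k \<in> I \<Longrightarrow> d k = e k" for d e
    using that by (auto simp: expansion_def intro!: sum.cong)
  \<comment> \<open>Uniqueness of the coefficient evolution gives one direction, existence of a
    solution with prescribed initial coefficients the other.\<close>
  have "exact_step \<phi> I V \<Delta>t u v \<longleftrightarrow> multiply_coeffs \<phi> I \<sigma> u v" for u v
  proof
    assume "exact_step \<phi> I V \<Delta>t u v"
    then obtain c where c: "solves_on \<phi> I V 0 (0 + \<Delta>t) c"
      "u = expansion \<phi> I (c 0)" "v = expansion \<phi> I (c \<Delta>t)"
      by (auto simp: exact_step_def)
    from unique[OF c(1)] have "v = expansion \<phi> I (\<lambda>k. \<sigma> k * c 0 k)"
      unfolding c(3) by (intro cong) simp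
    with c(2) show "multiply_coeffs \<phi> I \<sigma> u v"
      by (auto simp: multiply_coeffs_def)
  next
    assume "multiply_coeffs \<phi> I \<sigma> u v"
    then obtain d where d: "u = expansion \<phi> I d" "v = expansion \<phi> I (\<lambda>k. \<sigma> k * d k)"
      by (auto simp: multiply_coeffs_def)
    obtain c where c: "solves_on \<phi> I V 0 (0 + \<Delta>t) c" "\<And>k. k \<in> I \<Longrightarrow> c 0 k = d k"
      using exist[of 0 d] by blast
    have "u = expansion \<phi> I (c 0)" "v = expansion \<phi> I (c \<Delta>t)"
      using unique[OF c(1)] c(2) unfolding d by (auto intro!: cong)
    with c(1) show "exact_step \<phi> I V \<Delta>t u v"
      by (auto simp: exact_step_def)
  qed
  then have step: "exact_step \<phi> I V \<Delta>t = multiply_coeffs \<phi> I \<sigma>"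
    by (simp add: fun_eq_iff)
  \<comment> \<open>Both methods are the same expression in this relation, for either order and any
    integrator, the exact one included.\<close>
  from exist unique show ?thesis
    unfolding splitting_method_def filtered_method_def step by blast
qed

end
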